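(* Let $n\ge 2$ and $0<\alpha\le\pi$. The $n$-dimensional elliptic sector $\mathcal{D}^e_{\alpha,n}$ and the $n$-dimensional elliptic segment $\mathcal{S}^e_{\alpha,n}$ are $n$-bricks.
   Context: Use polar coordinates in $\mathbb{R}^2$: $(x,y)=(\rho\cos\theta,\rho\sin\theta)$ with $(\rho,\theta)\in[0,+\infty)\times(-\pi,\pi]$. For $0<\alpha\le\pi$ define the planar elliptic sector $\mathcal{D}^e_\alpha:=\{0\le\rho\le1,\ -\alpha\le\theta\le\alpha\}\subset\mathbb{R}^2$ and the planar elliptic segment $\mathcal{S}^e_\alpha:=\{(x,y)\in\mathbb{R}^2:\ x^2+y^2\le 1,\ x\ge\cos\alpha\}$. With $\mathbb{S}^{n-2}$ the unit sphere of $\mathbb{R}^{n-1}$ centered at the origin, define $$\mathcal{D}^e_{\alpha,n}:=\{(a,bu)\in\mathbb{R}\times\mathbb{R}^{n-1}:\ (a,b)\in\mathcal{D}^e_\alpha,\ u\in\mathbb{S}^{n-2}\},\qquad \mathcal{S}^e_{\alpha,n}:=\{(a,bu)\in\mathbb{R}\times\mathbb{R}^{n-1}:\ (a,b)\in\mathcal{S}^e_\alpha,\ u\in\mathbb{S}^{n-2}\}.$$ $\overline{B}_m$ denotes the closed unit ball of $\mathbb{R}^m$ centered at the origin. An $n$-dimensional semialgebraic set $T\subset\mathbb{R}^n$ is an $m$-brick if there exists a homotopy $H=(H_1,\ldots,H_n):[0,1]\times\overline{B}_m\to T$ such that: (1) each $H_i$ is the restriction to $[0,1]\times\overline{B}_m$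 of a polynomial of the ring $\mathcal{C}^0([0,1])[x_1,\ldots,x_m]$, where $\mathcal{C}^0([0,1])$ is the ring of continuous real functions on $[0,1]$; (2) $H(\{0\}\times\overline{B}_m)=T$ and $H(1,\cdot)$ is a constant map; (3) $H(\{t\}\times\overline{B}_m)\subset\operatorname{Int}(T)$ for each $t\in(0,1)$, where $\operatorname{Int}$ is the topological interior in $\mathbb{R}^n$. *)

theory Defs
  imports "HOL-Analysis.Analysis"
begin

text \<open>
  Semialgebraic subsets of a Euclidean space: the smallest family of sets that contains
  all \<open>{p = 0}\<close> and \<open>{p > 0}\<close>, for polynomial functions \<open>p\<close>, and is closed under the
  Boolean operations.
\<close>

inductive semialgebraic :: "'a::euclidean_space set \<Rightarrow> bool" where
  zero: "real_polynomial_function p \<Longrightarrow> semialgebraic {x. p x = 0}"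
| pos: "real_polynomial_function p \<Longrightarrow> semialgebraic {x. p x > 0}"
| inter: "semialgebraic S \<Longrightarrow> semialgebraic T \<Longrightarrow> semialgebraic (S \<inter> T)"
| union: "semialgebraic S \<Longrightarrow> semialgebraic T \<Longrightarrow> semialgebraic (S \<union> T)"
| compl: "semialgebraic S \<Longrightarrow> semialgebraic (- S)"

text \<open>
  The dimension of a semialgebraic set is the largest dimension of a cell it contains,
  a \<open>d\<close>-cell being a semialgebraic set homeomorphic to an open \<open>d\<close>-cube, equivalently to
  the \<open>d\<close>-dimensional real space.  The cells of a subset of a Euclidean space of dimension \<open>n\<close>
  have dimension at most \<open>n\<close>, so that the maximum exists for every nonempty \<open>S\<close>.
\<close>

definition semialgebraic_dim :: "'a::euclidean_space set \<Rightarrow> int" where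
  "semialgebraic_dim S =
    (if S = {} then -1
     else int (GREATEST d. \<exists>C\<subseteq>S. semialgebraic C \<and>
                              top_of_set C homeomorphic_space Euclidean_space d))"

text \<open>
  Functions on \<open>{0..1} \<times> cball 0 1\<close> that are restrictions of polynomials in the coordinates
  of the second argument with coefficients in the ring of continuous functions on \<open>{0..1}\<close>;
  \<open>c k\<close> is the coefficient of the monomial with exponent vector \<open>k\<close>.
\<close>

definition polynomial_over_C01 :: "(real \<times> 'e::euclidean_space \<Rightarrow> real) \<Rightarrow> bool" where
  "polynomial_over_C01 f \<longleftrightarrow>
    (\<exists>(K :: ('e \<Rightarrow> nat) set) (c :: ('e \<Rightarrow> nat) \<Rightarrow> real \<Rightarrow> real).
       finite K \<and> (\<forall>k\<in>K. continuous_on {0..1} (c k)) \<and>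
       (\<forall>t\<in>{0..1}. \<forall>x\<in>cball 0 1.
          f (t, x) = (\<Sum>k\<in>K. c k t * (\<Prod>b\<in>Basis. (x \<bullet> b) ^ k b))))"

text \<open>
  The parameter \<open>m\<close> of the notion of an \<open>m\<close>-brick is carried by a type: \<open>brick TYPE('e) T\<close>
  means that \<open>T\<close> is a \<open>DIM('e)\<close>-brick.
\<close>

definition brick :: "'e::euclidean_space itself \<Rightarrow> 'a::euclidean_space set \<Rightarrow> bool" where
  "brick _ T \<longleftrightarrow>
    semialgebraic T \<and> semialgebraic_dim T = int DIM('a) \<and>
    (\<exists>H :: real \<times> 'e \<Rightarrow> 'a.
       continuous_on ({0..1} \<times> cball 0 1) H \<and>
       H ` ({0..1} \<times> cball 0 1) \<subseteq> T \<and>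
       (\<forall>b\<in>Basis. polynomial_over_C01 (\<lambda>p. H p \<bullet> b)) \<and>
       H ` ({0} \<times> cball 0 1) = T \<and>
       (\<lambda>x. H (1, x)) constant_on cball 0 1 \<and>
       (\<forall>t\<in>{0<..<1}. H ` ({t} \<times> cball 0 1) \<subseteq> interior T))"

definition planar_sector :: "real \<Rightarrow> (real \<times> real) set" where
  "planar_sector \<alpha> =
    {(\<rho> * cos \<theta>, \<rho> * sin \<theta>) | \<rho> \<theta>.
       \<theta> \<in> {-pi<..pi} \<and> 0 \<le> \<rho> \<and> \<rho> \<le> 1 \<and> -\<alpha> \<le> \<theta> \<and> \<theta> \<le> \<alpha>}"

definition planar_segment :: "real \<Rightarrow> (real \<times> real) set" where
  "planar_segment \<alpha> = {(x, y). x\<^sup>2 + y\<^sup>2 \<le> 1 \<and> x \<ge> cos \<alpha>}"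

text \<open>
  The \<open>n\<close>-dimensional space is \<open>real \<times> (real ^ 'k)\<close> with \<open>n = 1 + CARD('k)\<close>.  Since index types are
  nonempty, the choices of \<open>'k\<close> correspond to the integers \<open>n \<ge> 2\<close>.
\<close>

definition elliptic_sector :: "real \<Rightarrow> (real \<times> (real ^ 'k::finite)) set" where
  "elliptic_sector \<alpha> = {(a, b *\<^sub>R u) | a b u. (a, b) \<in> planar_sector \<alpha> \<and> u \<in> sphere 0 1}"

definition elliptic_segment :: "real \<Rightarrow> (real \<times> (real ^ 'k::finite)) set" where
  "elliptic_segment \<alpha> = {(a, b *\<^sub>R u) | a b u. (a, b) \<in> planar_segment \<alpha> \<and> u \<in> sphere 0 1}"

end

theory Submission
  imports Defs "HOL-Homology.Invariance_of_Domain"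
begin

text \<open>
  If \<open>T\<close> is the image of the closed unit ball under a polynomial map \<open>f\<close> and is star-shaped with
  respect to every point of a nonempty open set, then the linear contraction \<open>(1 - t) f + t p\<close>
  to a point \<open>p\<close> of that set shows that \<open>T\<close> is a brick
  (\<open>brick_if_polynomial_image_and_open_kernel\<close>).  Segments are convex with nonempty interior, and a
  sector is star-shaped with respect to the points near \<open>(1 / 2, 0)\<close>; so the heart of the matter is
  to exhibit both sets as polynomial images of the ball.

  The difficulty is the spherical part of the boundary: a polynomial map that sends the unit circle
  of the plane to itself covers all of it (on the circle it is a power of \<open>z\<close> or of its conjugate)
  or is constant there, so a proper circular arc has to arise as a fold in the interior of the disc.
  The map \<open>w \<mapsto> (3 - \<bar>w\<bar>\<^sup>2) w / 2\<close> is such a fold along the unit sphere; it maps every ray from the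
  origin to itself.  Applied to a cone truncated by a hyperplane, it yields the sectors with
  \<open>\<alpha> \<le> pi / 4\<close> (\<open>polynomial_ball_image_thin_sector\<close>); the truncated cone is an image of the cylinder
  \<open>{0..1} \<times> cball 0 1\<close>, and the cylinder is an image of the ball.

  Complex squaring \<open>z \<mapsto> z\<^sup>2\<close> in the half-planes through the axis is the polynomial map
  \<open>(a, v) \<mapsto> (a\<^sup>2 - \<bar>v\<bar>\<^sup>2, 2 a v)\<close>.  It maps the sector of angle \<open>\<alpha>\<close> onto the sector of angle \<open>2 \<alpha>\<close>
  whenever \<open>\<alpha> \<le> pi / 2\<close>, so two squarings reach every angle up to \<open>pi\<close>.

  The segment of angle \<open>\<alpha>\<close> is the cone with apex \<open>q = (cos \<alpha>, 0)\<close> over the spherical part of its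
  boundary.  Therefore \<open>w \<mapsto> w\<^sup>2 + (1 - \<bar>w\<bar>\<^sup>2) q\<close>, with the squaring just described, maps the sector of
  angle \<open>\<alpha> / 2\<close> onto it: \<open>w\<^sup>2\<close> is \<open>\<bar>w\<bar>\<^sup>2\<close> times a point of this spherical cap, and the result is a convex
  combination of that point and \<open>q\<close>.
\<close>

section \<open>Polynomials with coefficients depending on the time\<close>

text \<open>
  Collecting the indices that carry the same monomial turns an indexed sum of monomials into the
  normal form that the definition asks for.  Sums and products of polynomials can then be treated
  with index sets in which a monomial occurs several times.
\<close>

lemma polynomial_over_C01_indexed:
  fixes f :: "real \<times> 'e::euclidean_space \<Rightarrow> real" and m :: "'i \<Rightarrow> 'e \<Rightarrow> nat"
  assumes "finite I" and cont: "\<And>i. i \<in> I \<Longrightarrow> continuous_on {0..1} (c i)"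
    and f: "\<And>t x. t \<in> {0..1} \<Longrightarrow> x \<in> cball 0 1 \<Longrightarrow>
              f (t, x) = (\<Sum>i\<in>I. c i t * (\<Prod>b\<in>Basis. (x \<bullet> b) ^ m i b))"
  shows "polynomial_over_C01 f"
  unfolding polynomial_over_C01_def
proof (intro exI conjI ballI)
  let ?c = "\<lambda>k t. \<Sum>i\<in>{i\<in>I. m i = k}. c i t"
  show "finite (m ` I)"
    using \<open>finite I\<close> by simp
  show "continuous_on {0..1} (?c k)" if "k \<in> m ` I" for k
    by (intro continuous_on_sum) (simp add: cont)
  fix t :: real and x :: 'e
  assume "t \<in> {0..1}" "x \<in> cball 0 1"
  then have "f (t, x) = (\<Sum>i\<in>I. c i t * (\<Prod>b\<in>Basis. (x \<bullet> b) ^ m i b))"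
    by (rule f)
  also have "\<dots> = (\<Sum>k\<in>m ` I. \<Sum>i\<in>{i\<in>I. m i = k}. c i t * (\<Prod>b\<in>Basis. (x \<bullet> b) ^ m i b))"
    using \<open>finite I\<close> by (rule sum.image_gen)
  also have "\<dots> = (\<Sum>k\<in>m ` I. ?c k t * (\<Prod>b\<in>Basis. (x \<bullet> b) ^ k b))"
    by (simp add: sum_distrib_right)
  finally show "f (t, x) = (\<Sum>k\<in>m ` I. ?c k t * (\<Prod>b\<in>Basis. (x \<bullet> b) ^ k b))" .
qed

lemma polynomial_over_C01_coefficient:
  assumes "continuous_on {0..1} c"
  shows "polynomial_over_C01 (\<lambda>p :: real \<times> 'e::euclidean_space. c (fst p))"
  by (rule polynomial_over_C01_indexed[of "{()}" "\<lambda>_. c" _ "\<lambda>_ _. 0"]) (use assms in auto)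

lemma polynomial_over_C01_coordinate:
  assumes "b \<in> Basis"
  shows "polynomial_over_C01 (\<lambda>p :: real \<times> 'e::euclidean_space. snd p \<bullet> b)"
proof (rule polynomial_over_C01_indexed[of "{()}" "\<lambda>_ _. 1" _ "\<lambda>_ b'. if b' = b then 1 else 0"])
  fix t :: real and x :: 'e
  have "(\<Prod>b'\<in>Basis. (x \<bullet> b') ^ (if b' = b then 1 else 0)) =
        (\<Prod>b'\<in>Basis. if b' = b then x \<bullet> b' else 1)"
    by (intro prod.cong) auto
  also have "\<dots> = x \<bullet> b"
    using assms by simp
  finally show "snd (t, x) \<bullet> b =
      (\<Sum>i\<in>{()}. 1 * (\<Prod>b'\<in>Basis. (x \<bullet> b') ^ (if b' = b then 1 else 0)))"
    by simp
qed auto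

lemma polynomial_over_C01E:
  fixes f :: "real \<times> 'e::euclidean_space \<Rightarrow> real"
  assumes "polynomial_over_C01 f"
  obtains K c where "finite K" "\<And>k. k \<in> K \<Longrightarrow> continuous_on {0..1} (c k)"
    "\<And>t x. t \<in> {0..1} \<Longrightarrow> x \<in> cball 0 1 \<Longrightarrow>
       f (t, x) = (\<Sum>k\<in>K. c k t * (\<Prod>b\<in>Basis. (x \<bullet> b) ^ k b))"
proof -
  obtain K c where "finite K \<and> (\<forall>k\<in>K. continuous_on {0..1} (c k)) \<and>
      (\<forall>t\<in>{0..1}. \<forall>x\<in>cball 0 1. f (t, x) = (\<Sum>k\<in>K. c k t * (\<Prod>b\<in>Basis. (x \<bullet> b) ^ k b)))"
    using assms unfolding polynomial_over_C01_def by (elim exE)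
  then show thesis
    by (intro that[of K c]) (simp_all only: Ball_def)
qed

lemma polynomial_over_C01_add:
  fixes f g :: "real \<times> 'e::euclidean_space \<Rightarrow> real"
  assumes "polynomial_over_C01 f" "polynomial_over_C01 g"
  shows "polynomial_over_C01 (\<lambda>p. f p + g p)"
proof -
  obtain K c where K: "finite K" "\<And>k. k \<in> K \<Longrightarrow> continuous_on {0..1} (c k)"
    "\<And>t x. t \<in> {0..1} \<Longrightarrow> x \<in> cball 0 1 \<Longrightarrow>
       f (t, x) = (\<Sum>k\<in>K. c k t * (\<Prod>b\<in>Basis. (x \<bullet> b) ^ k b))"
    using assms(1) by (rule polynomial_over_C01E) blast
  obtain L d where L: "finite L" "\<And>k. k \<in> L \<Longrightarrow> continuous_on {0..1} (d k)"
    "\<And>t x. t \<in> {0..1} \<Longrightarrow> x \<in> cball 0 1 \<Longrightarrow>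
       g (t, x) = (\<Sum>k\<in>L. d k t * (\<Prod>b\<in>Basis. (x \<bullet> b) ^ k b))"
    using assms(2) by (rule polynomial_over_C01E) blast
  show ?thesis
    by (rule polynomial_over_C01_indexed[of "K <+> L" "case_sum c d" _ "case_sum id id"])
       (use K L in \<open>auto simp: sum.Plus\<close>)
qed

lemma polynomial_over_C01_mult:
  fixes f g :: "real \<times> 'e::euclidean_space \<Rightarrow> real"
  assumes "polynomial_over_C01 f" "polynomial_over_C01 g"
  shows "polynomial_over_C01 (\<lambda>p. f p * g p)"
proof -
  obtain K c where K: "finite K" "\<And>k. k \<in> K \<Longrightarrow> continuous_on {0..1} (c k)"
    "\<And>t x. t \<in> {0..1} \<Longrightarrow> x \<in> cball 0 1 \<Longrightarrow>
       f (t, x) = (\<Sum>k\<in>K. c k t * (\<Prod>b\<in>Basis. (x \<bullet> b) ^ k b))"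
    using assms(1) by (rule polynomial_over_C01E) blast
  obtain L d where L: "finite L" "\<And>k. k \<in> L \<Longrightarrow> continuous_on {0..1} (d k)"
    "\<And>t x. t \<in> {0..1} \<Longrightarrow> x \<in> cball 0 1 \<Longrightarrow>
       g (t, x) = (\<Sum>k\<in>L. d k t * (\<Prod>b\<in>Basis. (x \<bullet> b) ^ k b))"
    using assms(2) by (rule polynomial_over_C01E) blast
  show ?thesis
  proof (rule polynomial_over_C01_indexed[of "K \<times> L" "\<lambda>(k, l) t. c k t * d l t" _
        "\<lambda>(k, l) b. k b + l b"])
    show "finite (K \<times> L)"
      using K(1) L(1) by simp
    show "continuous_on {0..1} (case i of (k, l) \<Rightarrow> \<lambda>t. c k t * d l t)" if "i \<in> K \<times> L" for i
      using that K(2) L(2) by (auto intro!: continuous_intros)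
    show "f (t, x) * g (t, x) = (\<Sum>i\<in>K \<times> L. (case i of (k, l) \<Rightarrow> \<lambda>t. c k t * d l t) t *
            (\<Prod>b\<in>Basis. (x \<bullet> b) ^ (case i of (k, l) \<Rightarrow> \<lambda>b. k b + l b) b))"
      if "t \<in> {0..1}" "x \<in> cball 0 1" for t x
      unfolding K(3)[OF that] L(3)[OF that] sum_product sum.cartesian_product
      by (intro sum.cong) (auto simp: power_add prod.distrib algebra_simps)
  qed
qed

lemma polynomial_over_C01_real_polynomial_function:
  fixes g :: "'e::euclidean_space \<Rightarrow> real"
  assumes "real_polynomial_function g"
  shows "polynomial_over_C01 (\<lambda>p. g (snd p))"
  using assms
proof induction
  case (linear g)
  have partial_sum: "polynomial_over_C01 (\<lambda>p :: real \<times> 'e. \<Sum>b\<in>B. g b * (snd p \<bullet> b))" if "B \<subseteq> Basis" for B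
    using finite_subset[OF that finite_Basis] that
  proof (induction B)
    case empty
    show ?case using polynomial_over_C01_coefficient[of "\<lambda>_. 0"] by simp
  next
    case (insert b B)
    then show ?case
      using polynomial_over_C01_add[OF polynomial_over_C01_mult[OF
            polynomial_over_C01_coefficient[of "\<lambda>_. g b"] polynomial_over_C01_coordinate[of b]]]
      by simp
  qed
  have expand: "g x = (\<Sum>b\<in>Basis. g b * (x \<bullet> b))" for x
  proof -
    have "linear g"
      using linear by (rule bounded_linear.linear)
    then have "(\<Sum>b\<in>Basis. (x \<bullet> b) *\<^sub>R g b) = g (\<Sum>b\<in>Basis. (x \<bullet> b) *\<^sub>R b)"
      by (simp add: linear_sum linear_cmul)
    then show ?thesis
      by (simp add: euclidean_representation mult.commute)
  qed
  have "(\<lambda>p :: real \<times> 'e. g (snd p)) = (\<lambda>p. \<Sum>b\<in>Basis. g b * (snd p \<bullet> b))"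
    by (intro ext expand)
  then show ?case
    by (rule ssubst[where P = polynomial_over_C01]) (rule partial_sum[OF order_refl])
next
  case (const c)
  show ?case using polynomial_over_C01_coefficient[of "\<lambda>_. c"] by simp
next
  case (add f g)
  then show ?case by (simp add: polynomial_over_C01_add)
next
  case (mult f g)
  then show ?case by (simp add: polynomial_over_C01_mult)
qed

section \<open>Dimension and semialgebraicity\<close>

text \<open>
  If \<open>d\<close> exceeded the dimension of the ambient space, then the cell would contain a continuous
  injective image of \<open>'a \<times> real\<close>, a space whose dimension is larger by one; this contradicts the
  invariance of dimension.
\<close>

lemma cell_dimension_le:
  fixes C :: "'a::euclidean_space set"
  assumes "top_of_set C homeomorphic_space Euclidean_space d"
  shows "d \<le> DIM('a)"
proof (rule ccontr)
  let ?n = "DIM('a \<times> real)"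
  assume "\<not> d \<le> DIM('a)"
  then have "?n \<le> d"
    by simp
  obtain h k where hk: "homeomorphic_maps (Euclidean_space d) (top_of_set C) h k"
    using assms homeomorphic_space_sym homeomorphic_space_def by blast
  obtain f and g :: "'a \<times> real \<Rightarrow> nat \<Rightarrow> real"
    where fg: "homeomorphic_maps (Euclidean_space ?n) euclidean f g"
    using homeomorphic_maps_Euclidean_space_euclidean by blast
  have sub: "Euclidean_space ?n = subtopology (Euclidean_space d) (topspace (Euclidean_space ?n))"
    by (metis Euclidean_space_def \<open>?n \<le> d\<close> inf.absorb_iff2 subset_Euclidean_space
        subtopology_subtopology topspace_Euclidean_space)
  have g: "continuous_map euclidean (Euclidean_space d) g"
    using fg sub unfolding homeomorphic_maps_def by (metis continuous_map_in_subtopology)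
  have "continuous_map euclidean (top_of_set C) (h \<circ> g)"
    using continuous_map_compose[OF g] hk unfolding homeomorphic_maps_def by blast
  then have "continuous_on UNIV (h \<circ> g)"
    by (simp add: continuous_map_in_subtopology)
  moreover have "inj (h \<circ> g)"
  proof (rule injI)
    fix x y assume "(h \<circ> g) x = (h \<circ> g) y"
    moreover have "k (h (g z)) = g z" for z
      using hk continuous_map_image_subset_topspace[OF g] by (auto simp: homeomorphic_maps_def)
    moreover have "f (g z) = z" for z
      using fg by (cases z) (simp add: homeomorphic_maps_def)
    ultimately show "x = y"
      by (metis comp_apply)
  qed
  ultimately have "?n \<le> DIM('a)"
    by (intro invariance_of_dimension[of UNIV "h \<circ> g"]) auto
  then show False
    by simp
qed

lemma real_polynomial_function_norm_square:
  fixes f :: "'a::real_normed_vector \<Rightarrow> 'b::euclidean_space"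
  assumes "polynomial_function f"
  shows "real_polynomial_function (\<lambda>x. (norm (f x))\<^sup>2)"
proof -
  have "(norm (f x))\<^sup>2 = (\<Sum>b\<in>Basis. (f x \<bullet> b) * (f x \<bullet> b))" for x
    unfolding power2_norm_eq_inner by (rule euclidean_inner)
  then show ?thesis
    using assms by (auto simp: polynomial_function_iff_Basis_inner
        intro!: real_polynomial_function_sum real_polynomial_function.intros(4))
qed

lemma semialgebraic_nonneg:
  assumes "real_polynomial_function p"
  shows "semialgebraic {x. p x \<ge> 0}"
proof -
  have "semialgebraic (- {x. - p x > 0})"
    by (intro semialgebraic.compl semialgebraic.pos real_polynomial_function_minus assms)
  moreover have "- {x. - p x > 0} = {x. p x \<ge> 0}"
    by auto
  ultimately show ?thesis
    by simp
qed

lemma semialgebraic_dim_eq_DIM: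
  fixes T :: "'a::euclidean_space set"
  assumes "interior T \<noteq> {}"
  shows "semialgebraic_dim T = int DIM('a)"
proof -
  obtain p e where "0 < e" and ball: "ball p e \<subseteq> T"
    using assms by (auto simp: mem_interior)
  have "real_polynomial_function (\<lambda>x. e\<^sup>2 - (norm (x - p))\<^sup>2)"
    by (intro real_polynomial_function_diff real_polynomial_function_norm_square
        polynomial_function_diff) auto
  then have "semialgebraic {x. e\<^sup>2 - (norm (x - p))\<^sup>2 > 0}"
    by (rule semialgebraic.pos)
  moreover have "(norm (x - p))\<^sup>2 < e\<^sup>2 \<longleftrightarrow> norm (x - p) < e" for x
    using \<open>0 < e\<close> power2_less_imp_less[of "norm (x - p)" e] power_strict_mono[of "norm (x - p)" e 2]
    by auto
  then have "{x. e\<^sup>2 - (norm (x - p))\<^sup>2 > 0} = ball p e"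
    by (simp add: set_eq_iff dist_norm norm_minus_commute[of p])
  ultimately have "semialgebraic (ball p e)"
    by simp
  moreover have "top_of_set (ball p e) homeomorphic_space Euclidean_space DIM('a)"
  proof -
    have "top_of_set (ball p e) homeomorphic_space top_of_set (UNIV :: 'a set)"
      using homeomorphic_ball_UNIV[OF \<open>0 < e\<close>] by (simp only: homeomorphic_space_iff_homeomorphic)
    then show ?thesis
      using homeomorphic_subspace_Euclidean_space_dim[OF subspace_UNIV, where 'a = 'a]
      by (auto intro: homeomorphic_space_trans)
  qed
  ultimately have "(GREATEST d. \<exists>C\<subseteq>T. semialgebraic C \<and>
      top_of_set C homeomorphic_space Euclidean_space d) = DIM('a)"
    using ball cell_dimension_le by (intro Greatest_equality) blast+
  moreover have "T \<noteq> {}"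
    using assms by auto
  ultimately show ?thesis
    by (simp add: semialgebraic_dim_def)
qed

section \<open>Bricks from star-shaped polynomial images of the ball\<close>

text \<open>
  The homotopy contracts \<open>f\<close> linearly to \<open>p\<close>.  An intermediate point \<open>(1 - t) y + t p\<close> lies in the
  image of the whole open set \<open>U\<close> under \<open>q \<mapsto> (1 - t) y + t q\<close>.  That image is open and, \<open>T\<close> being
  star-shaped with respect to every point of \<open>U\<close>, contained in \<open>T\<close>; so the point is interior.
\<close>

lemma brick_if_polynomial_image_and_open_kernel:
  fixes f :: "'e::euclidean_space \<Rightarrow> 'a::euclidean_space"
  assumes T: "semialgebraic T"
    and f: "polynomial_function f" "f ` cball 0 1 = T"
    and U: "open U" "p \<in> U" "\<And>q y. q \<in> U \<Longrightarrow> y \<in> T \<Longrightarrow> closed_segment q y \<subseteq> T"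
  shows "brick TYPE('e) T"
proof -
  have shrink: "(1 - t) *\<^sub>R y + t *\<^sub>R p \<in> interior T" if "y \<in> T" "0 < t" "t \<le> 1" for y t
  proof (rule interiorI)
    let ?V = "(\<lambda>q. (1 - t) *\<^sub>R y + t *\<^sub>R q) ` U"
    have "?V = (+) ((1 - t) *\<^sub>R y) ` ((*\<^sub>R) t ` U)"
      by auto
    then show "open ?V"
      using U(1) \<open>0 < t\<close> by (simp add: open_scaling open_translation)
    show "(1 - t) *\<^sub>R y + t *\<^sub>R p \<in> ?V"
      using U(2) by blast
    show "?V \<subseteq> T"
    proof clarify
      fix q assume "q \<in> U"
      have "(1 - t) *\<^sub>R y + t *\<^sub>R q \<in> closed_segment y q"
        unfolding in_segment by (intro exI[of _ t]) (use that in auto)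
      then show "(1 - t) *\<^sub>R y + t *\<^sub>R q \<in> T"
        using U(3)[OF \<open>q \<in> U\<close> \<open>y \<in> T\<close>] by (metis closed_segment_commute subsetD)
    qed
  qed
  have fT: "f x \<in> T" if "x \<in> cball 0 1" for x
    using f(2) that by blast
  then have "p \<in> interior T"
    using shrink[of "f 0" 1] by simp
  define H where "H = (\<lambda>(t, x). (1 - t) *\<^sub>R f x + t *\<^sub>R p)"
  have H: "H (t, x) = (1 - t) *\<^sub>R f x + t *\<^sub>R p" for t x
    by (simp add: H_def)
  have "continuous_on UNIV f"
    using f(1) by (rule continuous_on_polymonial_function)
  then have "continuous_on ({0..1} \<times> cball 0 1) H"
    unfolding H_def case_prod_beta
    by (intro continuous_on_add continuous_on_scaleR continuous_on_diff continuous_on_const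
        continuous_on_fst continuous_on_snd continuous_on_id
        continuous_on_compose2[of UNIV f _ snd]) auto
  moreover have "polynomial_over_C01 (\<lambda>p. H p \<bullet> b)" if "b \<in> Basis" for b
  proof -
    have "real_polynomial_function (\<lambda>x. f x \<bullet> b)"
      using f(1) that by (simp add: polynomial_function_iff_Basis_inner)
    then have "polynomial_over_C01 (\<lambda>z. (1 - fst z) * (f (snd z) \<bullet> b) + fst z * (p \<bullet> b))"
      by (intro polynomial_over_C01_add polynomial_over_C01_mult
          polynomial_over_C01_real_polynomial_function
          polynomial_over_C01_coefficient[of "\<lambda>t. 1 - t"] polynomial_over_C01_coefficient[of "\<lambda>t. t"]
          polynomial_over_C01_coefficient[of "\<lambda>t. p \<bullet> b"] continuous_intros)
    then show ?thesis
      by (simp add: H_def case_prod_beta inner_add_left)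
  qed
  moreover have "H ` ({0} \<times> cball 0 1) = T"
    using f(2) by (force simp: H)
  moreover have "(\<lambda>x. H (1, x)) constant_on cball 0 1"
    by (auto simp: H constant_on_def)
  moreover have "H ` ({t} \<times> cball 0 1) \<subseteq> interior T" if "t \<in> {0<..<1}" for t
    using that shrink[OF fT] by (auto simp: H)
  moreover have "H ` ({0..1} \<times> cball 0 1) \<subseteq> T"
  proof clarify
    fix t :: real and x :: 'e
    assume "t \<in> {0..1}" "x \<in> cball 0 1"
    then show "H (t, x) \<in> T"
      using fT[of x] shrink[OF fT, of x t] interior_subset[of T] by (cases "t = 0") (auto simp: H)
  qed
  ultimately show ?thesis
    unfolding brick_def using T semialgebraic_dim_eq_DIM[of T] \<open>p \<in> interior T\<close> by blast
qed

section \<open>Polynomial images of the closed ball\<close>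

lemma polynomial_function_Pair:
  assumes "polynomial_function f" "polynomial_function g"
  shows "polynomial_function (\<lambda>x. (f x, g x))"
proof -
  have "polynomial_function ((\<lambda>a. (a, 0)) \<circ> f)" "polynomial_function ((\<lambda>b. (0, b)) \<circ> g)"
    by (intro polynomial_function_compose polynomial_function_bounded_linear assms
        bounded_linear_Pair bounded_linear_ident bounded_linear_zero)+
  from polynomial_function_add[OF this] show ?thesis
    by simp
qed

lemma polynomial_function_fst: "polynomial_function fst"
  by (simp add: polynomial_function_bounded_linear bounded_linear_fst)

lemma polynomial_function_snd: "polynomial_function snd"
  by (simp add: polynomial_function_bounded_linear bounded_linear_snd)

lemmas polynomial_function_intros =
  polynomial_function_Pair polynomial_function_fst polynomial_function_snd
  polynomial_function_id polynomial_function_const polynomial_function_add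
  polynomial_function_diff polynomial_function_mult
  real_polynomial_function_norm_square[unfolded real_polynomial_function_eq]

text \<open>
  The ball lies in the space of the image, so that the property is preserved by polynomial
  self-maps of that space.
\<close>

definition polynomial_ball_image :: "'a::euclidean_space set \<Rightarrow> bool" where
  "polynomial_ball_image S \<longleftrightarrow> (\<exists>f :: 'a \<Rightarrow> 'a. polynomial_function f \<and> f ` cball 0 1 = S)"

lemma polynomial_ball_imageI:
  fixes f :: "'a::euclidean_space \<Rightarrow> 'a"
  shows "polynomial_function f \<Longrightarrow> f ` cball 0 1 = S \<Longrightarrow> polynomial_ball_image S"
  unfolding polynomial_ball_image_def by blast

lemma polynomial_ball_image_image:
  fixes g :: "'a::euclidean_space \<Rightarrow> 'a"
  assumes "polynomial_ball_image S" "polynomial_function g"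
  shows "polynomial_ball_image (g ` S)"
  using assms polynomial_function_compose unfolding polynomial_ball_image_def
  by (metis image_comp)

text \<open>
  On the norm this is the cubic \<open>\<rho> (3 - \<rho>\<^sup>2) / 2\<close>, which increases from 0 to its maximum 1 at
  \<open>\<rho> = 1\<close> and descends to 0 at \<open>\<rho> = sqrt 3\<close>.  The map thus keeps rays from the origin and folds the
  space along the unit sphere.  It produces a spherical boundary from a domain whose own boundary
  is not spherical.
\<close>

definition radial_fold :: "'a::euclidean_space \<Rightarrow> 'a" where
  "radial_fold w = ((3 - (norm w)\<^sup>2) / 2) *\<^sub>R w"

lemma polynomial_function_radial_fold: "polynomial_function radial_fold"
proof -
  have "polynomial_function (\<lambda>w :: 'a. ((1 / 2) *\<^sub>R (3 - (norm w)\<^sup>2)) *\<^sub>R w)"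
    by (intro polynomial_function_intros)
  then show ?thesis
    by (simp add: radial_fold_def[abs_def])
qed

text \<open>
  The difference \<open>1 - \<rho> (3 - \<rho>\<^sup>2) / 2\<close> has a double zero at the fold:
  it equals \<open>(\<rho> - 1)\<^sup>2 (\<rho> + 2) / 2\<close>.
\<close>

lemma norm_radial_fold_le_1:
  assumes "(norm w)\<^sup>2 \<le> 3"
  shows "norm (radial_fold w) \<le> 1"
proof -
  have "1 - norm w * (3 - (norm w)\<^sup>2) / 2 = (norm w - 1)\<^sup>2 * (norm w + 2) / 2"
    by (simp add: power2_eq_square field_simps)
  also have "\<dots> \<ge> 0"
    by simp
  finally show ?thesis
    using assms by (simp add: radial_fold_def mult.commute)
qed

text \<open>
  Along the segment from 0 to \<open>z\<close> the fold enlarges norms, so the intermediate value theorem finds a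
  preimage of \<open>z\<close> that is no longer than \<open>z\<close> itself.
\<close>

lemma radial_fold_covers_cball:
  assumes "norm z \<le> 1"
  obtains \<mu> where "0 \<le> \<mu>" "\<mu> \<le> 1" "radial_fold (\<mu> *\<^sub>R z) = z"
proof -
  let ?h = "\<lambda>\<mu>. \<mu> * (3 - (\<mu> * norm z)\<^sup>2) / 2"
  have "(norm z)\<^sup>2 \<le> 1"
    using assms by (simp add: power_le_one)
  then have "\<exists>\<mu>\<ge>0. \<mu> \<le> 1 \<and> ?h \<mu> = 1"
    by (intro IVT' continuous_intros) auto
  then obtain \<mu> where \<mu>: "0 \<le> \<mu>" "\<mu> \<le> 1" "?h \<mu> = 1"
    by blast
  have "radial_fold (\<mu> *\<^sub>R z) = ?h \<mu> *\<^sub>R z"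
    using \<mu>(1) by (simp add: radial_fold_def mult.commute)
  with \<mu> that show thesis
    by simp
qed

text \<open>
  A product is an image of the ball if each factor is already covered by points whose squared norm
  is at most \<open>1 / 2\<close>, since then the two coordinates can be chosen independently.  The first
  coordinate map \<open>4 x\<^sup>2 (1 - x\<^sup>2)\<close> covers \<open>{0..1}\<close> for \<open>x\<^sup>2 \<le> 1 / 2\<close>, and the fold scaled by \<open>sqrt 2\<close>
  covers the unit ball from the ball of radius \<open>1 / sqrt 2\<close>.
\<close>

lemma polynomial_ball_image_cylinder:
  "polynomial_ball_image ({0..1 :: real} \<times> cball (0 :: 'b::euclidean_space) 1)"
proof -
  let ?g = "\<lambda>w :: real \<times> 'b. (4 * (fst w)\<^sup>2 * (1 - (fst w)\<^sup>2), radial_fold (sqrt 2 *\<^sub>R snd w))"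
  have "polynomial_function (\<lambda>w :: real \<times> 'b. 4 *\<^sub>R ((norm (fst w))\<^sup>2 *\<^sub>R (1 - (norm (fst w))\<^sup>2)))"
    by (intro polynomial_function_intros)
  moreover have "polynomial_function (radial_fold \<circ> (\<lambda>w :: real \<times> 'b. sqrt 2 *\<^sub>R snd w))"
    by (rule polynomial_function_compose[OF _ polynomial_function_radial_fold])
       (intro polynomial_function_intros)
  ultimately have "polynomial_function ?g"
    using polynomial_function_Pair by (fastforce simp: mult.assoc)
  moreover have "?g ` cball 0 1 = {0..1} \<times> cball 0 1"
  proof (intro equalityI subsetI)
    fix z assume "z \<in> ?g ` cball 0 1"
    then obtain x v where z: "z = ?g (x, v)" and "norm (x, v) \<le> 1"
      by auto
    then have 1: "x\<^sup>2 + (norm v)\<^sup>2 \<le> 1"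
      by (simp add: norm_Pair)
    then have "x\<^sup>2 \<le> 1" "2 * (norm v)\<^sup>2 \<le> 3"
      using zero_le_power2[of x] zero_le_power2[of "norm v"] by linarith+
    then have "x\<^sup>2 \<le> 1" "(norm (sqrt 2 *\<^sub>R v))\<^sup>2 \<le> 3"
      by (simp_all add: power_mult_distrib)
    moreover have "1 - 4 * x\<^sup>2 * (1 - x\<^sup>2) = (1 - 2 * x\<^sup>2)\<^sup>2"
      by (simp add: power2_eq_square algebra_simps)
    then have "4 * x\<^sup>2 * (1 - x\<^sup>2) \<le> 1"
      by (metis diff_ge_0_iff_ge zero_le_power2)
    ultimately show "z \<in> {0..1} \<times> cball 0 1"
      using norm_radial_fold_le_1[of "sqrt 2 *\<^sub>R v"] by (simp add: z)
  next
    fix z :: "real \<times> 'b" assume "z \<in> {0..1} \<times> cball 0 1"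
    then obtain r s where z: "z = (r, s)" "0 \<le> r" "r \<le> 1" "norm s \<le> 1"
      by auto
    obtain \<mu> where \<mu>: "0 \<le> \<mu>" "\<mu> \<le> 1" "radial_fold (\<mu> *\<^sub>R s) = s"
      using radial_fold_covers_cball[OF z(4)] .
    \<comment> \<open>the smaller root of \<open>4 y (1 - y) = r\<close>\<close>
    define y where "y = (1 - sqrt (1 - r)) / 2"
    define x where "x = sqrt y"
    define v where "v = (\<mu> / sqrt 2) *\<^sub>R s"
    have y: "0 \<le> y" "y \<le> 1 / 2"
      using z(2,3) by (auto simp: y_def real_sqrt_ge_zero)
    then have "x\<^sup>2 = y"
      by (simp add: x_def)
    moreover have "4 * y * (1 - y) = 1 - (sqrt (1 - r))\<^sup>2"
      by (simp add: y_def power2_eq_square field_simps)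
    ultimately have "?g (x, v) = z"
      using \<mu>(3) z(3) by (simp add: z v_def)
    moreover have "norm v \<le> 1 / sqrt 2"
      using \<mu> z(4) mult_mono[of \<mu> 1 "norm s" 1] by (simp add: v_def divide_right_mono)
    then have "(norm v)\<^sup>2 \<le> 1 / 2"
      using power_mono[of "norm v" "1 / sqrt 2" 2] by (simp add: power_divide)
    then have "(x, v) \<in> cball 0 1"
      using y \<open>x\<^sup>2 = y\<close> by (simp add: norm_Pair)
    ultimately show "z \<in> ?g ` cball 0 1"
      by blast
  qed
  ultimately show ?thesis
    by (rule polynomial_ball_imageI)
qed

section \<open>Polar and implicit descriptions of sectors and segments\<close>

lemma norm_polar:
  assumes "0 \<le> \<rho>" "norm u = 1"
  shows "norm (\<rho> * cos \<theta>, (\<rho> * sin \<theta>) *\<^sub>R u) = \<rho>"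
proof -
  have "(\<rho> * cos \<theta>)\<^sup>2 + (\<rho> * sin \<theta>)\<^sup>2 = \<rho>\<^sup>2"
    by (simp add: power_mult_distrib flip: distrib_left)
  then show ?thesis
    using assms by (simp add: norm_Pair)
qed

lemma polar_coordinates:
  fixes w :: "real \<times> 'b::euclidean_space"
  obtains \<theta> u where "0 \<le> \<theta>" "\<theta> \<le> pi" "norm u = 1"
    "w = (norm w * cos \<theta>, (norm w * sin \<theta>) *\<^sub>R u)"
proof (cases "w = 0")
  case True
  then show thesis
    by (intro that[of 0 "SOME i. i \<in> Basis"]) (auto simp: zero_prod_def)
next
  case False
  define \<theta> where "\<theta> = arccos (fst w / norm w)"
  define u where "u = (if snd w = 0 then SOME i. i \<in> Basis else sgn (snd w))"
  have "norm w > 0" "\<bar>fst w\<bar> \<le> norm w"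
    using False norm_fst_le[of "fst w" "snd w"] by auto
  then have "\<bar>fst w / norm w\<bar> \<le> 1"
    by simp
  then have "-1 \<le> fst w / norm w" "fst w / norm w \<le> 1"
    by linarith+
  then have \<theta>: "0 \<le> \<theta>" "\<theta> \<le> pi" "cos \<theta> = fst w / norm w"
    unfolding \<theta>_def by (simp_all only: arccos_lbound arccos_ubound cos_arccos)
  then have x: "norm w * cos \<theta> = fst w"
    using \<open>norm w > 0\<close> by simp
  have "(norm w * cos \<theta>)\<^sup>2 + (norm w * sin \<theta>)\<^sup>2 = (norm w)\<^sup>2"
    by (simp add: power_mult_distrib flip: distrib_left)
  moreover have "(norm w)\<^sup>2 = (fst w)\<^sup>2 + (norm (snd w))\<^sup>2"
    by (cases w) (simp add: norm_Pair)
  ultimately have "(norm w * sin \<theta>)\<^sup>2 = (norm (snd w))\<^sup>2"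
    by (simp add: x)
  moreover have "0 \<le> norm w * sin \<theta>"
    using sin_ge_zero[OF \<theta>(1,2)] by simp
  ultimately have "norm w * sin \<theta> = norm (snd w)"
    by (rule power2_eq_imp_eq) simp
  moreover have "norm u = 1" "norm (snd w) *\<^sub>R u = snd w"
    by (auto simp: u_def norm_sgn sgn_div_norm)
  ultimately show thesis
    using \<theta>(1,2) x by (intro that[of \<theta> u]) (simp_all add: prod_eq_iff)
qed

text \<open>
  Negative angles are superfluous, since replacing \<open>(\<theta>, u)\<close> by \<open>(-\<theta>, -u)\<close> does not change the point.
\<close>

lemma elliptic_sector_polar:
  assumes "0 < \<alpha>" "\<alpha> \<le> pi"
  shows "(elliptic_sector \<alpha> :: (real \<times> (real ^ 'k::finite)) set) = {(\<rho> * cos \<theta>, (\<rho> * sin \<theta>) *\<^sub>R u) | \<rho> \<theta> u.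
    0 \<le> \<rho> \<and> \<rho> \<le> 1 \<and> 0 \<le> \<theta> \<and> \<theta> \<le> \<alpha> \<and> norm u = 1}"
    (is "_ = ?P")
proof (intro equalityI subsetI)
  fix w :: "real \<times> (real ^ 'k)" assume "w \<in> elliptic_sector \<alpha>"
  then obtain \<rho> \<theta> u where w: "w = (\<rho> * cos \<theta>, (\<rho> * sin \<theta>) *\<^sub>R u)"
      "0 \<le> \<rho>" "\<rho> \<le> 1" "-\<alpha> \<le> \<theta>" "\<theta> \<le> \<alpha>" "norm u = 1"
    by (auto simp: elliptic_sector_def planar_sector_def)
  show "w \<in> ?P"
  proof (cases "0 \<le> \<theta>")
    case True
    then show ?thesis
      using w by blast
  next
    case False
    then have "w = (\<rho> * cos (-\<theta>), (\<rho> * sin (-\<theta>)) *\<^sub>R (-u))" "0 \<le> -\<theta>" "-\<theta> \<le> \<alpha>" "norm (-u) = 1"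
      using w by auto
    then show ?thesis
      using w(2,3) by blast
  qed
next
  fix w :: "real \<times> (real ^ 'k)" assume "w \<in> ?P"
  then obtain \<rho> \<theta> u where w: "w = (\<rho> * cos \<theta>, (\<rho> * sin \<theta>) *\<^sub>R u)"
      "0 \<le> \<rho>" "\<rho> \<le> 1" "0 \<le> \<theta>" "\<theta> \<le> \<alpha>" "norm u = 1"
    by blast
  then have "(\<rho> * cos \<theta>, \<rho> * sin \<theta>) \<in> planar_sector \<alpha>"
    unfolding planar_sector_def using assms by force
  then show "w \<in> elliptic_sector \<alpha>"
    unfolding elliptic_sector_def using w(1,6) by auto
qed

text \<open>
  The cosine decreases on \<open>{0..pi}\<close>, so the bound on the angle becomes a bound on its cosine.
  The sector thus is the intersection of the ball with a circular cone; it is nonconvex for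
  \<open>pi / 2 < \<alpha> < pi\<close>.
\<close>

lemma elliptic_sector_eq_cone:
  assumes "0 < \<alpha>" "\<alpha> \<le> pi"
  shows "(elliptic_sector \<alpha> :: (real \<times> (real ^ 'k::finite)) set) = {w. norm w \<le> 1 \<and> cos \<alpha> * norm w \<le> fst w}"
proof (intro equalityI subsetI)
  fix w :: "real \<times> (real ^ 'k)" assume "w \<in> elliptic_sector \<alpha>"
  then obtain \<rho> \<theta> u where w: "w = (\<rho> * cos \<theta>, (\<rho> * sin \<theta>) *\<^sub>R u)"
      "0 \<le> \<rho>" "\<rho> \<le> 1" "0 \<le> \<theta>" "\<theta> \<le> \<alpha>" "norm u = 1"
    unfolding elliptic_sector_polar[OF assms] by blast
  have "cos \<alpha> \<le> cos \<theta>"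
    using w assms by (intro cos_monotone_0_pi_le) auto
  then have "cos \<alpha> * \<rho> \<le> \<rho> * cos \<theta>"
    using w(2) by (simp add: mult.commute mult_left_mono)
  moreover have "norm w = \<rho>"
    using w norm_polar by blast
  ultimately show "w \<in> {w. norm w \<le> 1 \<and> cos \<alpha> * norm w \<le> fst w}"
    using w(1,3) by simp
next
  fix w :: "real \<times> (real ^ 'k)" assume w: "w \<in> {w. norm w \<le> 1 \<and> cos \<alpha> * norm w \<le> fst w}"
  obtain \<theta> u where \<theta>: "0 \<le> \<theta>" "\<theta> \<le> pi" "norm u = 1"
    "w = (norm w * cos \<theta>, (norm w * sin \<theta>) *\<^sub>R u)"
    by (rule polar_coordinates)
  show "w \<in> elliptic_sector \<alpha>"
  proof (cases "w = 0")
    case True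
    then have "w = (0 * cos \<alpha>, (0 * sin \<alpha>) *\<^sub>R u)"
      by (simp add: zero_prod_def)
    then show ?thesis
      unfolding elliptic_sector_polar[OF assms]
      by (intro CollectI exI[of _ 0] exI[of _ \<alpha>] exI[of _ u] conjI) (use assms \<theta>(3) in simp_all)
  next
    case False
    have "cos \<alpha> * norm w \<le> norm w * cos \<theta>"
      using w arg_cong[OF \<theta>(4), of fst] by simp
    then have "cos \<alpha> \<le> cos \<theta>"
      using False by (simp add: mult.commute)
    then have "\<theta> \<le> \<alpha>"
      using \<theta>(1,2) assms by (simp add: cos_mono_le_eq)
    then show ?thesis
      unfolding elliptic_sector_polar[OF assms]
      by (intro CollectI exI[of _ "norm w"] exI[of _ \<theta>] exI[of _ u] conjI \<theta>) (use w in simp_all)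
  qed
qed

lemma elliptic_segment_eq:
  "(elliptic_segment \<alpha> :: (real \<times> (real ^ 'k::finite)) set) = {w. norm w \<le> 1 \<and> cos \<alpha> \<le> fst w}"
proof (intro equalityI subsetI)
  fix w :: "real \<times> (real ^ 'k)" assume "w \<in> elliptic_segment \<alpha>"
  then show "w \<in> {w. norm w \<le> 1 \<and> cos \<alpha> \<le> fst w}"
    by (auto simp: elliptic_segment_def planar_segment_def norm_Pair power_mult_distrib)
next
  fix w :: "real \<times> (real ^ 'k)" assume w: "w \<in> {w. norm w \<le> 1 \<and> cos \<alpha> \<le> fst w}"
  obtain \<theta> u where \<theta>: "norm u = 1" "w = (norm w * cos \<theta>, (norm w * sin \<theta>) *\<^sub>R u)"
    by (rule polar_coordinates)
  let ?a = "norm w * cos \<theta>" and ?b = "norm w * sin \<theta>"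
  have "?a\<^sup>2 + ?b\<^sup>2 = (norm w)\<^sup>2"
    by (simp add: power_mult_distrib flip: distrib_left)
  also have "\<dots> \<le> 1"
    using w by (simp add: power_le_one)
  finally have "(?a, ?b) \<in> planar_segment \<alpha>"
    using w arg_cong[OF \<theta>(2), of fst] by (simp add: planar_segment_def)
  then show "w \<in> elliptic_segment \<alpha>"
    unfolding elliptic_segment_def
    by (intro CollectI exI[of _ ?a] exI[of _ ?b] exI[of _ u] conjI \<theta>(2)) (use \<theta>(1) in simp_all)
qed

section \<open>Sectors and segments as polynomial images\<close>

text \<open>
  The map \<open>(r, s) \<mapsto> (r, r tan \<alpha> s)\<close> sends the cylinder onto the cone of half-angle \<open>\<alpha>\<close> that is cut off
  by the hyperplane where the first coordinate is 1.  This cone contains the sector; as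
  \<open>tan \<alpha> \<le> 1\<close>, its points have norm at most \<open>sqrt 2\<close>, which is below \<open>sqrt 3\<close>.  The radial fold,
  which keeps rays, therefore maps it onto the sector.
\<close>

lemma polynomial_ball_image_thin_sector:
  assumes "0 < \<alpha>" "\<alpha> \<le> pi / 4"
  shows "polynomial_ball_image (elliptic_sector \<alpha> :: (real \<times> (real ^ 'k::finite)) set)"
proof -
  have "\<alpha> < pi / 2"
    using assms pi_gt_zero by linarith
  then have cos: "0 < cos \<alpha>" and sin: "0 < sin \<alpha>"
    using assms by (auto intro: cos_gt_zero sin_gt_zero)
  then have tan: "0 < tan \<alpha>" "cos \<alpha> * tan \<alpha> = sin \<alpha>"
    by (auto simp: tan_def)
  have "tan \<alpha> \<le> tan (pi / 4)"
  proof (cases "\<alpha> = pi / 4")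
    case False
    then show ?thesis
      using assms tan_monotone[of \<alpha> "pi / 4"] by simp
  qed (simp only: order_refl)
  then have "tan \<alpha> \<le> 1"
    by (simp add: tan_45)
  let ?h = "\<lambda>z :: real \<times> (real ^ 'k). (fst z, (fst z * tan \<alpha>) *\<^sub>R snd z)"
  let ?T = "elliptic_sector \<alpha> :: (real \<times> (real ^ 'k)) set"
  have T: "?T = {w. norm w \<le> 1 \<and> cos \<alpha> * norm w \<le> fst w}"
    using assms pi_gt_zero by (intro elliptic_sector_eq_cone) linarith+
  have "polynomial_function (\<lambda>z :: real \<times> (real ^ 'k). (fst z, fst z *\<^sub>R (tan \<alpha> *\<^sub>R snd z)))"
    by (intro polynomial_function_intros)
  then have "polynomial_function ?h"
    by simp
  then have poly: "polynomial_function (radial_fold \<circ> ?h)"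
    by (rule polynomial_function_compose) (rule polynomial_function_radial_fold)
  have image: "(radial_fold \<circ> ?h) ` ({0..1} \<times> cball 0 1) = ?T"
  proof (intro equalityI subsetI)
    fix w :: "real \<times> (real ^ 'k)" assume "w \<in> (radial_fold \<circ> ?h) ` ({0..1} \<times> cball 0 1)"
    then obtain r s where rs: "0 \<le> r" "r \<le> 1" "norm s \<le> 1" and w: "w = radial_fold (?h (r, s))"
      by auto
    define z where "z = ?h (r, s)"
    have fst: "fst z = r" and norm: "(norm z)\<^sup>2 = r\<^sup>2 * (1 + (tan \<alpha> * norm s)\<^sup>2)"
      by (simp_all add: z_def norm_Pair power_mult_distrib algebra_simps)
    have "tan \<alpha> * norm s \<le> 1"
      using tan(1) \<open>tan \<alpha> \<le> 1\<close> rs(3) mult_mono[of "tan \<alpha>" 1 "norm s" 1] by simp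
    then have "(tan \<alpha> * norm s)\<^sup>2 \<le> 1"
      using tan(1) by (intro power_le_one) simp_all
    moreover have "r\<^sup>2 \<le> 1"
      using rs(1,2) by (rule power_le_one)
    ultimately have "(norm z)\<^sup>2 \<le> 1 * 2"
      unfolding norm by (intro mult_mono) simp_all
    then have z3: "(norm z)\<^sup>2 \<le> 3"
      by simp
    have "(cos \<alpha> * norm z)\<^sup>2 = r\<^sup>2 * ((cos \<alpha>)\<^sup>2 + (sin \<alpha> * norm s)\<^sup>2)"
      unfolding power_mult_distrib norm tan(2)[symmetric]
      by (simp add: power_mult_distrib algebra_simps)
    also have "\<dots> \<le> r\<^sup>2 * ((cos \<alpha>)\<^sup>2 + (sin \<alpha>)\<^sup>2)"
      using rs(3) sin by (intro mult_left_mono add_left_mono power_mono) (simp_all add: mult_le_cancel_left1)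
    finally have "(cos \<alpha> * norm z)\<^sup>2 \<le> r\<^sup>2"
      by simp
    then have cone: "cos \<alpha> * norm z \<le> r"
      using rs(1) by (rule power2_le_imp_le)
    define l where "l = (3 - (norm z)\<^sup>2) / 2"
    have l: "0 \<le> l" "w = l *\<^sub>R z"
      using z3 by (simp_all add: w radial_fold_def l_def z_def)
    have "cos \<alpha> * norm w \<le> fst w"
      using mult_left_mono[OF cone l(1)] l(1) by (simp add: l(2) fst mult.left_commute)
    then show "w \<in> ?T"
      using norm_radial_fold_le_1[OF z3] by (simp add: T w z_def)
  next
    fix w :: "real \<times> (real ^ 'k)" assume "w \<in> ?T"
    then have w: "norm w \<le> 1" "cos \<alpha> * norm w \<le> fst w"
      by (auto simp: T)
    obtain \<mu> where \<mu>: "0 \<le> \<mu>" "\<mu> \<le> 1" "radial_fold (\<mu> *\<^sub>R w) = w"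
      using radial_fold_covers_cball[OF w(1)] .
    define r v where "r = \<mu> * fst w" and "v = \<mu> *\<^sub>R snd w"
    have rv: "(r, v) = \<mu> *\<^sub>R w"
      by (simp add: r_def v_def prod_eq_iff)
    have "norm (r, v) \<le> 1"
      using \<mu> w(1) mult_mono[of \<mu> 1 "norm w" 1] by (simp add: rv)
    then have "r \<le> 1"
      using norm_fst_le[of r v] by simp
    have cone: "cos \<alpha> * norm (r, v) \<le> r"
      unfolding rv using mult_left_mono[OF w(2) \<mu>(1)] \<mu>(1) by (simp add: r_def mult.left_commute)
    then have "0 \<le> r"
      using cos by (meson less_imp_le mult_nonneg_nonneg norm_ge_zero order_trans)
    have "(cos \<alpha>)\<^sup>2 * (r\<^sup>2 + (norm v)\<^sup>2) \<le> r\<^sup>2"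
      using power_mono[OF cone, of 2] cos by (simp add: norm_Pair power_mult_distrib)
    then have "(cos \<alpha>)\<^sup>2 * (norm v)\<^sup>2 \<le> r\<^sup>2 * (1 - (cos \<alpha>)\<^sup>2)"
      by (simp add: algebra_simps)
    then have "(cos \<alpha> * norm v)\<^sup>2 \<le> (r * sin \<alpha>)\<^sup>2"
      by (simp add: power_mult_distrib sin_squared_eq)
    then have "cos \<alpha> * norm v \<le> r * sin \<alpha>"
      by (rule power2_le_imp_le[OF _ mult_nonneg_nonneg]) (use \<open>0 \<le> r\<close> sin in simp_all)
    then have v: "norm v \<le> r * tan \<alpha>"
      using cos by (simp add: tan_def field_simps)
    define s where "s = (1 / (r * tan \<alpha>)) *\<^sub>R v"
    have "norm s \<le> 1" "?h (r, s) = (r, v)"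
      using v tan(1) \<open>0 \<le> r\<close> by (cases "r = 0"; auto simp: s_def field_simps)+
    then have "w = (radial_fold \<circ> ?h) (r, s)" "(r, s) \<in> {0..1} \<times> cball 0 1"
      using \<open>0 \<le> r\<close> \<open>r \<le> 1\<close> \<mu>(3) rv by auto
    then show "w \<in> (radial_fold \<circ> ?h) ` ({0..1} \<times> cball 0 1)"
      by (rule image_eqI)
  qed
  show ?thesis
    using polynomial_ball_image_image[OF polynomial_ball_image_cylinder poly] unfolding image .
qed

text \<open>
  In the half-plane spanned by the axis and a unit vector \<open>u\<close> this is the complex squaring map.
\<close>

definition angle_double :: "real \<times> 'b::real_inner \<Rightarrow> real \<times> 'b" where
  "angle_double w = ((fst w)\<^sup>2 - (norm (snd w))\<^sup>2, (2 * fst w) *\<^sub>R snd w)"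

lemma polynomial_function_angle_double:
  "polynomial_function (angle_double :: real \<times> 'b::euclidean_space \<Rightarrow> real \<times> 'b)"
proof -
  have "polynomial_function (\<lambda>w :: real \<times> 'b.
      ((norm (fst w))\<^sup>2 - (norm (snd w))\<^sup>2, 2 *\<^sub>R (fst w *\<^sub>R snd w)))"
    by (intro polynomial_function_intros)
  then show ?thesis
    by (simp add: angle_double_def[abs_def])
qed

lemma angle_double_polar:
  assumes "norm u = 1"
  shows "angle_double (\<rho> * cos \<theta>, (\<rho> * sin \<theta>) *\<^sub>R u) =
    (\<rho>\<^sup>2 * cos (2 * \<theta>), (\<rho>\<^sup>2 * sin (2 * \<theta>)) *\<^sub>R u)"
  unfolding angle_double_def cos_double sin_double
  using assms by (simp add: power2_eq_square algebra_simps)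

lemma angle_double_image_elliptic_sector:
  assumes "0 < \<alpha>" "\<alpha> \<le> pi / 2"
  shows "angle_double ` elliptic_sector \<alpha> =
    (elliptic_sector (2 * \<alpha>) :: (real \<times> (real ^ 'k::finite)) set)"
proof -
  have 1: "\<alpha> \<le> pi" and 2: "0 < 2 * \<alpha>" "2 * \<alpha> \<le> pi"
    using assms by auto
  show ?thesis
  proof (intro equalityI subsetI)
    fix y :: "real \<times> (real ^ 'k)" assume "y \<in> angle_double ` elliptic_sector \<alpha>"
    then obtain \<rho> \<theta> u where "y = angle_double (\<rho> * cos \<theta>, (\<rho> * sin \<theta>) *\<^sub>R u)"
        and w: "0 \<le> \<rho>" "\<rho> \<le> 1" "0 \<le> \<theta>" "\<theta> \<le> \<alpha>" "norm u = 1"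
      unfolding elliptic_sector_polar[OF assms(1) 1] by blast
    then have "y = (\<rho>\<^sup>2 * cos (2 * \<theta>), (\<rho>\<^sup>2 * sin (2 * \<theta>)) *\<^sub>R u)"
      by (simp add: angle_double_polar)
    then show "y \<in> elliptic_sector (2 * \<alpha>)"
      unfolding elliptic_sector_polar[OF 2]
      by (intro CollectI exI[of _ "\<rho>\<^sup>2"] exI[of _ "2 * \<theta>"] exI[of _ u] conjI)
         (use w in \<open>simp_all add: power_le_one\<close>)
  next
    fix y :: "real \<times> (real ^ 'k)" assume "y \<in> elliptic_sector (2 * \<alpha>)"
    then obtain \<rho> \<theta> u where y: "y = (\<rho> * cos \<theta>, (\<rho> * sin \<theta>) *\<^sub>R u)"
        and w: "0 \<le> \<rho>" "\<rho> \<le> 1" "0 \<le> \<theta>" "\<theta> \<le> 2 * \<alpha>" "norm u = 1"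
      unfolding elliptic_sector_polar[OF 2] by blast
    have "y = angle_double (sqrt \<rho> * cos (\<theta> / 2), (sqrt \<rho> * sin (\<theta> / 2)) *\<^sub>R u)"
      using w by (simp add: angle_double_polar y)
    moreover have "(sqrt \<rho> * cos (\<theta> / 2), (sqrt \<rho> * sin (\<theta> / 2)) *\<^sub>R u) \<in> elliptic_sector \<alpha>"
      unfolding elliptic_sector_polar[OF assms(1) 1]
      by (intro CollectI exI[of _ "sqrt \<rho>"] exI[of _ "\<theta> / 2"] exI[of _ u] conjI)
         (use w in simp_all)
    ultimately show "y \<in> angle_double ` elliptic_sector \<alpha>"
      by (rule image_eqI)
  qed
qed

lemma norm_angle_double: "norm (angle_double w) = (norm w)\<^sup>2"
proof -
  have "((fst w)\<^sup>2 - (norm (snd w))\<^sup>2)\<^sup>2 + (2 * fst w * norm (snd w))\<^sup>2 =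
      ((fst w)\<^sup>2 + (norm (snd w))\<^sup>2)\<^sup>2"
    by (simp add: power2_eq_square algebra_simps)
  then show ?thesis
    by (cases w) (simp add: angle_double_def norm_Pair abs_mult power_mult_distrib)
qed

lemma polynomial_ball_image_elliptic_sector:
  assumes "0 < \<alpha>" "\<alpha> \<le> pi"
  shows "polynomial_ball_image (elliptic_sector \<alpha> :: (real \<times> (real ^ 'k::finite)) set)"
proof -
  have double: "polynomial_ball_image (elliptic_sector (2 * \<beta>) :: (real \<times> (real ^ 'k)) set)"
    if "0 < \<beta>" "\<beta> \<le> pi / 2"
      "polynomial_ball_image (elliptic_sector \<beta> :: (real \<times> (real ^ 'k)) set)" for \<beta>
    using polynomial_ball_image_image[OF that(3) polynomial_function_angle_double]
    unfolding angle_double_image_elliptic_sector[OF that(1,2)] .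
  have quarter: "polynomial_ball_image (elliptic_sector (\<alpha> / 4) :: (real \<times> (real ^ 'k)) set)"
    using assms by (intro polynomial_ball_image_thin_sector) simp_all
  have half: "polynomial_ball_image (elliptic_sector (2 * (\<alpha> / 4)) :: (real \<times> (real ^ 'k)) set)"
    by (rule double[OF _ _ quarter]) (use assms in simp_all)
  have "polynomial_ball_image (elliptic_sector (2 * (2 * (\<alpha> / 4))) :: (real \<times> (real ^ 'k)) set)"
    by (rule double[OF _ _ half]) (use assms in simp_all)
  then show ?thesis
    by simp
qed

text \<open>
  The parameter \<open>2 / norm (z - q)\<close> moves \<open>q\<close> by a vector of length 2, hence to norm at least 1;
  the intermediate value theorem applies between it and the parameter 1.
\<close>

lemma ray_exits_unit_ball:
  fixes q z :: "'a::real_normed_vector"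
  assumes "norm q \<le> 1" "norm z \<le> 1" "z \<noteq> q"
  obtains s where "1 \<le> s" "norm (q + s *\<^sub>R (z - q)) = 1"
proof -
  have pos: "0 < norm (z - q)"
    using assms(3) by simp
  have "norm (z - q) \<le> 2"
    using norm_triangle_ineq4[of z q] assms(1,2) by simp
  then have far: "1 \<le> 2 / norm (z - q)"
    using pos by simp
  have "norm ((2 / norm (z - q)) *\<^sub>R (z - q)) = 2"
    using pos by simp
  then have "1 \<le> norm (q + (2 / norm (z - q)) *\<^sub>R (z - q))"
    using norm_diff_ineq[of "(2 / norm (z - q)) *\<^sub>R (z - q)" q] assms(1)
    by (simp only: add.commute[of q])
  then have "\<exists>s\<ge>1. s \<le> 2 / norm (z - q) \<and> norm (q + s *\<^sub>R (z - q)) = 1"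
    using assms(2) far by (intro IVT' continuous_intros) simp_all
  then show thesis
    using that by blast
qed

text \<open>
  Put \<open>q = (cos \<alpha>, 0)\<close>.  Writing \<open>y = \<rho> e\<close> with \<open>\<rho> = norm y\<close> and \<open>e\<close> on the sphere, the map sends \<open>y\<close>
  to the convex combination \<open>\<rho> e + (1 - \<rho>) q\<close>.  The points \<open>e\<close> run through the spherical cap, which
  bounds the sector and the segment alike, so the image is the cone with apex \<open>q\<close> over the cap.
  This cone is the segment, because a ray from \<open>q\<close> through another point of the segment leaves the
  ball through the cap.
\<close>

lemma elliptic_segment_as_image:
  assumes "0 < \<alpha>" "\<alpha> \<le> pi"
  shows "(\<lambda>y. y + (1 - norm y) *\<^sub>R (cos \<alpha>, 0)) ` elliptic_sector \<alpha> =
    (elliptic_segment \<alpha> :: (real \<times> (real ^ 'k::finite)) set)"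
proof -
  note sector = elliptic_sector_eq_cone[OF assms, where 'k = 'k]
  define q :: "real \<times> (real ^ 'k)" where "q = (cos \<alpha>, 0)"
  have q: "fst q = cos \<alpha>" "norm q \<le> 1"
    by (simp_all add: q_def)
  show ?thesis
    unfolding q_def[symmetric]
  proof (intro equalityI subsetI)
    fix z :: "real \<times> (real ^ 'k)"
    assume "z \<in> (\<lambda>y. y + (1 - norm y) *\<^sub>R q) ` elliptic_sector \<alpha>"
    then obtain y where y: "z = y + (1 - norm y) *\<^sub>R q" "norm y \<le> 1" "cos \<alpha> * norm y \<le> fst y"
      unfolding sector by blast
    have "norm z \<le> norm y + (1 - norm y) * norm q"
      using norm_triangle_ineq[of y "(1 - norm y) *\<^sub>R q"] y(2) by (simp add: y(1))
    also have "\<dots> \<le> 1"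
      using mult_left_mono[OF q(2), of "1 - norm y"] y(2) by simp
    finally have "norm z \<le> 1" .
    moreover have "cos \<alpha> \<le> fst z"
      using y(3) by (simp add: y(1) q(1) algebra_simps)
    ultimately show "z \<in> elliptic_segment \<alpha>"
      unfolding elliptic_segment_eq by blast
  next
    fix z :: "real \<times> (real ^ 'k)" assume "z \<in> elliptic_segment \<alpha>"
    then have z: "norm z \<le> 1" "cos \<alpha> \<le> fst z"
      unfolding elliptic_segment_eq by blast+
    show "z \<in> (\<lambda>y. y + (1 - norm y) *\<^sub>R q) ` elliptic_sector \<alpha>"
    proof (cases "z = q")
      case True
      then have "z = 0 + (1 - norm (0 :: real \<times> (real ^ 'k))) *\<^sub>R q"
        by simp
      moreover have "0 \<in> (elliptic_sector \<alpha> :: (real \<times> (real ^ 'k)) set)"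
        unfolding sector by simp
      ultimately show ?thesis
        by (rule image_eqI)
    next
      case False
      obtain s where s: "1 \<le> s" "norm (q + s *\<^sub>R (z - q)) = 1"
        using ray_exits_unit_ball[OF q(2) z(1) False] .
      define e where "e = q + s *\<^sub>R (z - q)"
      define y where "y = (1 / s) *\<^sub>R e"
      have y: "norm y = 1 / s"
        using s by (simp add: y_def e_def)
      have "z = y + (1 - norm y) *\<^sub>R q"
        unfolding y using s(1) by (simp add: y_def e_def algebra_simps)
      moreover have "cos \<alpha> \<le> fst e"
        using s(1) z(2) by (simp add: e_def q(1))
      then have "cos \<alpha> * norm y \<le> fst y"
        unfolding y using s(1) by (simp add: y_def divide_right_mono)
      then have "y \<in> elliptic_sector \<alpha>"
        unfolding sector using s(1) y by simp
      ultimately show ?thesis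
        by (rule image_eqI)
    qed
  qed
qed

text \<open>
  The norm occurring in the previous map is not polynomial, but it becomes so after doubling
  angles, which squares norms.
\<close>

lemma polynomial_ball_image_elliptic_segment:
  assumes "0 < \<alpha>" "\<alpha> \<le> pi"
  shows "polynomial_ball_image (elliptic_segment \<alpha> :: (real \<times> (real ^ 'k::finite)) set)"
proof -
  let ?q = "(cos \<alpha>, 0) :: real \<times> (real ^ 'k)"
  let ?g = "\<lambda>w :: real \<times> (real ^ 'k). angle_double w + (1 - (norm w)\<^sup>2) *\<^sub>R ?q"
  have half: "0 < \<alpha> / 2" "\<alpha> / 2 \<le> pi / 2" "\<alpha> / 2 \<le> pi"
    using assms by auto
  have "polynomial_function ?g"
    by (intro polynomial_function_intros polynomial_function_angle_double)
  then have "polynomial_ball_image (?g ` elliptic_sector (\<alpha> / 2))"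
    by (rule polynomial_ball_image_image[OF polynomial_ball_image_elliptic_sector[OF half(1,3)]])
  also have "?g ` elliptic_sector (\<alpha> / 2) =
      (\<lambda>y. y + (1 - norm y) *\<^sub>R ?q) ` angle_double ` elliptic_sector (\<alpha> / 2)"
    by (simp add: image_image norm_angle_double)
  also have "\<dots> = elliptic_segment \<alpha>"
    unfolding angle_double_image_elliptic_sector[OF half(1,2)]
    using elliptic_segment_as_image[OF assms] by simp
  finally show ?thesis .
qed

section \<open>Semialgebraicity and star-shapedness\<close>

text \<open>
  Squaring \<open>cos \<alpha> * norm w \<le> fst w\<close> removes the square root in the norm.  The sign of \<open>cos \<alpha>\<close>
  decides whether the sign condition on \<open>fst w\<close> is added conjunctively or disjunctively.
\<close>

lemma semialgebraic_elliptic_sector: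
  assumes "0 < \<alpha>" "\<alpha> \<le> pi"
  shows "semialgebraic (elliptic_sector \<alpha> :: (real \<times> (real ^ 'k::finite)) set)"
proof -
  let ?B = "{w :: real \<times> (real ^ 'k). 1 - (norm w)\<^sup>2 \<ge> 0}"
  let ?P = "{w :: real \<times> (real ^ 'k). fst w \<ge> 0}"
  let ?C = "{w :: real \<times> (real ^ 'k). (norm (fst w))\<^sup>2 - (cos \<alpha>)\<^sup>2 *\<^sub>R (norm w)\<^sup>2 \<ge> 0}"
  let ?D = "{w :: real \<times> (real ^ 'k). (cos \<alpha>)\<^sup>2 *\<^sub>R (norm w)\<^sup>2 - (norm (fst w))\<^sup>2 \<ge> 0}"
  have sa: "semialgebraic ?B" "semialgebraic ?P" "semialgebraic ?C" "semialgebraic ?D"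
    by (intro semialgebraic_nonneg; unfold real_polynomial_function_eq;
        intro polynomial_function_intros)+
  have B: "1 - (norm w)\<^sup>2 \<ge> 0 \<longleftrightarrow> norm w \<le> 1" for w :: "real \<times> (real ^ 'k)"
    using abs_square_le_1[of "norm w"] by simp
  have sq: "(norm (fst w))\<^sup>2 - (cos \<alpha>)\<^sup>2 *\<^sub>R (norm w)\<^sup>2 = (fst w)\<^sup>2 - (cos \<alpha> * norm w)\<^sup>2"
    for w :: "real \<times> (real ^ 'k)"
    by (simp add: power_mult_distrib)
  show ?thesis
  proof (cases "0 \<le> cos \<alpha>")
    case True
    have "cos \<alpha> * norm w \<le> fst w \<longleftrightarrow> fst w \<ge> 0 \<and> (fst w)\<^sup>2 - (cos \<alpha> * norm w)\<^sup>2 \<ge> 0"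
      for w :: "real \<times> (real ^ 'k)"
    proof -
      have "0 \<le> cos \<alpha> * norm w"
        using True by simp
      then show ?thesis
        using power_mono[of "cos \<alpha> * norm w" "fst w" 2] power2_le_imp_le[of "cos \<alpha> * norm w" "fst w"]
        by linarith
    qed
    then have "elliptic_sector \<alpha> = ?B \<inter> (?P \<inter> ?C)"
      unfolding elliptic_sector_eq_cone[OF assms] B sq by auto
    then show ?thesis
      using sa by (simp only: semialgebraic.inter)
  next
    case False
    have "cos \<alpha> * norm w \<le> fst w \<longleftrightarrow> fst w \<ge> 0 \<or> (cos \<alpha> * norm w)\<^sup>2 - (fst w)\<^sup>2 \<ge> 0"
      for w :: "real \<times> (real ^ 'k)"
    proof -
      have "cos \<alpha> * norm w \<le> 0"
        using False by (simp add: mult_nonpos_nonneg)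
      then show ?thesis
        using power_mono[of "- fst w" "- (cos \<alpha> * norm w)" 2]
          power2_le_imp_le[of "- fst w" "- (cos \<alpha> * norm w)"]
        by (cases "fst w \<ge> 0") auto
    qed
    then have "elliptic_sector \<alpha> = ?B \<inter> (?P \<union> ?D)"
      unfolding elliptic_sector_eq_cone[OF assms] B by (auto simp: power_mult_distrib)
    then show ?thesis
      using sa by (simp only: semialgebraic.inter semialgebraic.union)
  qed
qed

lemma semialgebraic_elliptic_segment:
  "semialgebraic (elliptic_segment \<alpha> :: (real \<times> (real ^ 'k::finite)) set)"
proof -
  let ?B = "{w :: real \<times> (real ^ 'k). 1 - (norm w)\<^sup>2 \<ge> 0}"
  let ?P = "{w :: real \<times> (real ^ 'k). fst w - cos \<alpha> \<ge> 0}"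
  have "semialgebraic ?B" "semialgebraic ?P"
    by (intro semialgebraic_nonneg; unfold real_polynomial_function_eq;
        intro polynomial_function_intros)+
  then have "semialgebraic (?B \<inter> ?P)"
    by (rule semialgebraic.inter)
  also have "?B \<inter> ?P = elliptic_segment \<alpha>"
    unfolding elliptic_segment_eq by (auto simp: abs_square_le_1)
  finally show ?thesis .
qed

text \<open>
  For \<open>c \<ge> 0\<close> the cone is convex, for \<open>c < 0\<close> it is the complement of an open convex cone.  In both
  cases it is star-shaped with respect to the points that also lie in the cone of \<open>\<bar>c\<bar>\<close>, and both
  cases follow from \<open>\<bar>norm (v + w) - norm w\<bar> \<le> norm v\<close>.
\<close>

lemma segment_in_cone:
  fixes q y z :: "real \<times> 'b::real_normed_vector"
  assumes "z \<in> closed_segment q y"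
    and "\<bar>c\<bar> * norm q \<le> fst q" "c * norm y \<le> fst y"
  shows "c * norm z \<le> fst z"
proof -
  obtain t where t: "0 \<le> t" "t \<le> 1" "z = (1 - t) *\<^sub>R q + t *\<^sub>R y"
    using assms(1) by (auto simp: in_segment)
  let ?a = "(1 - t) * norm q" and ?b = "t * norm y"
  have norms: "norm ((1 - t) *\<^sub>R q) = ?a" "norm (t *\<^sub>R y) = ?b"
    using t by simp_all
  have "norm z \<le> ?b + ?a" "?b - ?a \<le> norm z"
    using norm_triangle_ineq[of "t *\<^sub>R y" "(1 - t) *\<^sub>R q"]
      norm_diff_ineq[of "t *\<^sub>R y" "(1 - t) *\<^sub>R q"] 
    unfolding t(3) norms by (simp_all only: add.commute)
  then have "\<bar>norm z - ?b\<bar> \<le> ?a"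
    by (simp add: abs_le_iff)
  then have "\<bar>c\<bar> * \<bar>norm z - ?b\<bar> \<le> \<bar>c\<bar> * ?a"
    by (rule mult_left_mono) simp
  then have "c * (norm z - ?b) \<le> \<bar>c\<bar> * ?a"
    using abs_ge_self[of "c * (norm z - ?b)"] by (simp add: abs_mult)
  moreover have "(1 - t) * (\<bar>c\<bar> * norm q) \<le> (1 - t) * fst q" "t * (c * norm y) \<le> t * fst y"
    using t assms(2,3) by (auto intro!: mult_left_mono)
  ultimately show ?thesis
    by (simp add: t(3) algebra_simps)
qed

section \<open>Sectors and segments are bricks\<close>

text \<open>
  For \<open>\<alpha> < pi\<close> the open kernel consists of the interior points of the unit ball that lie strictly
  inside the convex cone of \<open>\<bar>cos \<alpha>\<bar>\<close>.  For \<open>\<alpha> = pi\<close> that cone degenerates to a half-line, but the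
  sector is then the whole ball and the interior of the ball serves.
\<close>

lemma elliptic_sector_brick:
  assumes "0 < \<alpha>" "\<alpha> \<le> pi"
  shows "brick TYPE(real \<times> (real ^ 'k::finite)) (elliptic_sector \<alpha> :: (real \<times> (real ^ 'k)) set)"
proof -
  note sector = elliptic_sector_eq_cone[OF assms, where 'k = 'k]
  let ?T = "elliptic_sector \<alpha> :: (real \<times> (real ^ 'k)) set"
  obtain f :: "real \<times> (real ^ 'k) \<Rightarrow> real \<times> (real ^ 'k)"
    where f: "polynomial_function f" "f ` cball 0 1 = ?T"
    using polynomial_ball_image_elliptic_sector[OF assms] unfolding polynomial_ball_image_def by blast
  define U where "U = {q :: real \<times> (real ^ 'k). norm q < 1 \<and> (\<bar>cos \<alpha>\<bar> * norm q < fst q \<or> \<alpha> = pi)}"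
  show ?thesis
  proof (rule brick_if_polynomial_image_and_open_kernel[OF semialgebraic_elliptic_sector[OF assms] f])
    show "open U"
      unfolding U_def
      by (intro open_Collect_conj open_Collect_disj open_Collect_less open_Collect_const
          continuous_intros)
    have "\<bar>cos \<alpha>\<bar> < 1 \<or> \<alpha> = pi"
    proof (cases "\<alpha> = pi")
      case False
      then have "cos pi < cos \<alpha>" "cos \<alpha> < cos 0"
        by (intro cos_monotone_0_pi; use assms in simp)+
      then show ?thesis
        by (simp add: abs_less_iff)
    qed simp
    then show "(1 / 2, 0) \<in> U"
      by (auto simp: U_def)
    show "closed_segment q y \<subseteq> ?T" if "q \<in> U" "y \<in> ?T" for q y
    proof
      fix z assume z: "z \<in> closed_segment q y"
      have y: "norm y \<le> 1" "cos \<alpha> * norm y \<le> fst y"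
        using \<open>y \<in> ?T\<close> unfolding sector by auto
      have "q \<in> cball 0 1" "y \<in> cball 0 1"
        using \<open>q \<in> U\<close> y by (auto simp: U_def)
      then have "z \<in> cball 0 1"
        using z closed_segment_subset[OF _ _ convex_cball] by blast
      moreover have "cos \<alpha> * norm z \<le> fst z"
      proof (cases "\<alpha> = pi")
        case True
        then show ?thesis
          using norm_fst_le[of "fst z" "snd z"] by simp
      next
        case False
        then show ?thesis
          using segment_in_cone[OF z _ y(2)] \<open>q \<in> U\<close> by (simp add: U_def)
      qed
      ultimately show "z \<in> ?T"
        unfolding sector by simp
    qed
  qed
qed

lemma elliptic_segment_brick:
  assumes "0 < \<alpha>" "\<alpha> \<le> pi"
  shows "brick TYPE(real \<times> (real ^ 'k::finite)) (elliptic_segment \<alpha> :: (real \<times> (real ^ 'k)) set)"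
proof -
  let ?T = "elliptic_segment \<alpha> :: (real \<times> (real ^ 'k)) set"
  obtain f :: "real \<times> (real ^ 'k) \<Rightarrow> real \<times> (real ^ 'k)"
    where f: "polynomial_function f" "f ` cball 0 1 = ?T"
    using polynomial_ball_image_elliptic_segment[OF assms] unfolding polynomial_ball_image_def by blast
  define U where "U = {q :: real \<times> (real ^ 'k). norm q < 1 \<and> cos \<alpha> < fst q}"
  have "?T = cball 0 1 \<inter> {w. (1, 0) \<bullet> w \<ge> cos \<alpha>}"
    unfolding elliptic_segment_eq by auto
  then have "convex ?T"
    by (simp only: convex_Int convex_cball convex_halfspace_ge)
  show ?thesis
  proof (rule brick_if_polynomial_image_and_open_kernel[OF semialgebraic_elliptic_segment f])
    show "open U"
      unfolding U_def by (intro open_Collect_conj open_Collect_less continuous_intros)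
    have "cos \<alpha> < 1"
      using assms cos_monotone_0_pi[of 0 \<alpha>] by simp
    have midpoint: "\<bar>(1 + c) / 2\<bar> < 1" "c < (1 + c) / 2" if "-1 \<le> c" "c < 1" for c :: real
      using that by (simp_all add: abs_less_iff)
    show "((1 + cos \<alpha>) / 2, 0) \<in> U"
      unfolding U_def mem_Collect_eq fst_conv norm_Pair2 real_norm_def
      by (intro conjI midpoint cos_ge_minus_one \<open>cos \<alpha> < 1\<close>)
    show "closed_segment q y \<subseteq> ?T" if "q \<in> U" "y \<in> ?T" for q y
    proof (rule closed_segment_subset[OF _ that(2) \<open>convex ?T\<close>])
      show "q \<in> ?T"
        using that(1) unfolding elliptic_segment_eq U_def by simp
    qed
  qed
qed

theorem theorem2p23:
  fixes \<alpha> :: real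
  assumes "0 < \<alpha>" and "\<alpha> \<le> pi"
  shows "brick TYPE(real \<times> (real ^ 'k::finite)) (elliptic_sector \<alpha> :: (real \<times> (real ^ 'k)) set)
       \<and> brick TYPE(real \<times> (real ^ 'k)) (elliptic_segment \<alpha> :: (real \<times> (real ^ 'k)) set)"
  using elliptic_sector_brick[OF assms] elliptic_segment_brick[OF assms] by (rule conjI)

end
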